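(* Let $R$ be a weakly fadelian ring. Then $R$ is simple, i.e. the only two-sided ideals of $R$ are $0$ and $R$.
   Context: All rings are nontrivial ($1\neq 0$), unital, associative, and not assumed commutative. A ring $R$ is weakly fadelian if for every nonzero $a\in R$ there exist $b,c\in R$ such that $1=ab+ca$. *)

theory Defs
  imports "HOL-Algebra.Ideal"
begin

(* The library locale "ring" is unital, associative and not assumed commutative, but it
   admits the zero ring, so nontriviality is imposed here. *)
locale nontrivial_ring = ring R for R (structure) +
  assumes one_neq_zero: "\<one> \<noteq> \<zero>"

locale weakly_fadelian_ring = nontrivial_ring R for R (structure) +
  assumes weakly_fadelian:
    "\<And>a. a \<in> carrier R \<Longrightarrow> a \<noteq> \<zero> \<Longrightarrow>
       \<exists>b \<in> carrier R. \<exists>c \<in> carrier R. \<one> = a \<otimes> b \<oplus> c \<otimes> a"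

(* The library predicate "ideal" means two-sided ideal, also for noncommutative rings. *)
locale simple_ring = nontrivial_ring R for R (structure) +
  assumes ideals_trivial: "\<And>I. ideal I R \<Longrightarrow> I = {\<zero>} \<or> I = carrier R"

end

theory Submission
  imports Defs
begin

text \<open>A two-sided ideal that contains \<open>a\<close> contains \<open>a \<otimes> b\<close> because it is a right ideal and
  \<open>c \<otimes> a\<close> because it is a left ideal. So for \<open>a \<noteq> \<zero>\<close> the weakly fadelian identity
  \<open>\<one> = a \<otimes> b \<oplus> c \<otimes> a\<close> puts \<open>\<one>\<close> into the ideal.\<close>

theorem proposition1:
  fixes R (structure)
  assumes "weakly_fadelian_ring R"
  shows "simple_ring R"
proof -
  interpret weakly_fadelian_ring R by (fact assms)
  show ?thesis
  proof
    fix I assume "ideal I R"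
    then interpret I: ideal I R .
    show "I = {\<zero>} \<or> I = carrier R"
    proof (cases "I \<subseteq> {\<zero>}")
      case True
      then show ?thesis using I.zero_closed by blast
    next
      case False
      then obtain a where a: "a \<in> I" "a \<noteq> \<zero>" by blast
      then obtain b c where "b \<in> carrier R" "c \<in> carrier R" and one: "\<one> = a \<otimes> b \<oplus> c \<otimes> a"
        using weakly_fadelian[OF I.Icarr] by blast
      then have "a \<otimes> b \<in> I" "c \<otimes> a \<in> I"
        using a(1) by (simp_all add: I.I_r_closed I.I_l_closed)
      then have "\<one> \<in> I"
        unfolding one by (rule I.a_closed)
      then show ?thesis using I.one_imp_carrier by blast
    qed
  qed
qed

end
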